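(* Assume the Continuum Hypothesis (or just $\mathfrak{p}=\mathfrak{c}$). Then there exist a $\gamma$-set $X\subseteq\mathbb{R}$ and a set $Y\subseteq\mathbb{R}$ with Hausdorff dimension zero such that the Hausdorff dimension of the algebraic sum $$X+Y=\{x+y : x\in X,\ y\in Y\}$$ is $1$. In particular, the Hausdorff dimension $\dim(X\times Y)$ of $X\times Y\subseteq\mathbb{R}^2$ satisfies $\dim(X\times Y)\ge 1$.
   Context: Hausdorff dimension: for $Z\subseteq\mathbb{R}^k$, $\dim(Z)$ is the infimum of all positive $\delta$ such that for each positive $\epsilon$ there is a cover $\{I_n\}_{n\in\mathbb{N}}$ of $Z$ with $\sum_{n}\operatorname{diam}(I_n)^\delta<\epsilon$. Covers: let $X$ be a topological space. An open cover $\mathcal{U}$ of $X$ is an $\omega$-cover of $X$ if each finite subset of $X$ is contained in some member of $\mathcal{U}$, but $X$ is not contained in any member of $\mathcal{U}$. A cover $\mathcal{U}$ of $X$ is a $\gamma$-cover of $X$ if it is infinite and each element of $X$ belongs to all but finitely many members of $\mathcal{U}$. The space $X$ is a $\gamma$-set if each (open) $\omega$-cover of $X$ contains a $\gamma$-cover of $X$. Subsets of $\mathbb{R}$ carry the subspace topology. The cardinal $\mathfrak{p}$: for infinite sets $A,B\subseteq\mathbb{N}$ write $A\subseteq^* B$ if $A\setminus B$ is finite. For a family $\mathcal{F}$ of infinite subsets of $\mathbb{N}$, a pseudointersection of $\mathcal{F}$ is an infinite set $P\subseteq\mathbb{N}$ with $P\subseteq^* B$ for each $B\in\mathcal{F}$.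 $\mathcal{F}$ is centered if each finite subcollection of $\mathcal{F}$ has a pseudointersection. $\mathfrak{p}$ is the minimal cardinality of a centered family which does not have a pseudointersection, and $\mathfrak{c}$ is the cardinality of the continuum. The Continuum Hypothesis implies $\mathfrak{p}=\mathfrak{c}$. *)

theory Defs
  imports "HOL-Analysis.Analysis"
begin

unbundle cardinal_syntax

text \<open>
  The library's \<^const>\<open>diameter\<close> is a real number without a meaningful value on unbounded sets,
  and \<^const>\<open>suminf\<close> has none on divergent series. A cover that makes the sum of the
  \<open>\<delta>\<close>-th powers of the diameters finite consists of bounded sets and has a summable series, so
  both are demanded explicitly. The exponent \<open>\<delta>\<close> is positive, hence empty sets and singletons
  contribute \<open>0 powr \<delta> = 0\<close>.
\<close>

definition hausdorff_dim :: "'a::euclidean_space set \<Rightarrow> ereal" where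
  "hausdorff_dim Z = Inf {ereal \<delta> | \<delta>. \<delta> > 0 \<and>
     (\<forall>\<epsilon>::real. \<epsilon> > 0 \<longrightarrow>
        (\<exists>I :: nat \<Rightarrow> 'a set. Z \<subseteq> (\<Union>n. I n) \<and> (\<forall>n. bounded (I n)) \<and>
           summable (\<lambda>n. diameter (I n) powr \<delta>) \<and>
           (\<Sum>n. diameter (I n) powr \<delta>) < \<epsilon>))}"

definition cover_of :: "'a topology \<Rightarrow> 'a set set \<Rightarrow> bool" where
  "cover_of T U \<longleftrightarrow> \<Union>U = topspace T"

definition open_omega_cover :: "'a topology \<Rightarrow> 'a set set \<Rightarrow> bool" where
  "open_omega_cover T U \<longleftrightarrow> cover_of T U \<and> (\<forall>u\<in>U. openin T u) \<and>
     (\<forall>F. finite F \<and> F \<subseteq> topspace T \<longrightarrow> (\<exists>u\<in>U. F \<subseteq> u)) \<and>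
     \<not> (\<exists>u\<in>U. topspace T \<subseteq> u)"

definition gamma_cover :: "'a topology \<Rightarrow> 'a set set \<Rightarrow> bool" where
  "gamma_cover T U \<longleftrightarrow> cover_of T U \<and> infinite U \<and>
     (\<forall>x\<in>topspace T. finite {u\<in>U. x \<notin> u})"

definition gamma_space :: "'a topology \<Rightarrow> bool" where
  "gamma_space T \<longleftrightarrow> (\<forall>U. open_omega_cover T U \<longrightarrow> (\<exists>V\<subseteq>U. gamma_cover T V))"

definition gamma_set :: "real set \<Rightarrow> bool" where
  "gamma_set X \<longleftrightarrow> gamma_space (top_of_set X)"

definition almost_subset :: "nat set \<Rightarrow> nat set \<Rightarrow> bool" where
  "almost_subset A B \<longleftrightarrow> finite (A - B)"

definition pseudointersection :: "nat set set \<Rightarrow> nat set \<Rightarrow> bool" where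
  "pseudointersection F P \<longleftrightarrow> infinite P \<and> (\<forall>B\<in>F. almost_subset P B)"

definition centered :: "nat set set \<Rightarrow> bool" where
  "centered F \<longleftrightarrow> (\<forall>B\<in>F. infinite B) \<and>
     (\<forall>G. finite G \<and> G \<subseteq> F \<longrightarrow> (\<exists>P. pseudointersection G P))"

definition centered_no_pseudo :: "nat set set \<Rightarrow> bool" where
  "centered_no_pseudo F \<longleftrightarrow> centered F \<and> \<not> (\<exists>P. pseudointersection F P)"

text \<open>
  Cardinals are represented by cardinal orders and compared up to \<open>=o\<close>; the number \<open>p\<close> is a
  cardinal of minimal size among the cardinals of the families in question. The lemmas below show
  that it exists and has the defining properties.
\<close>

definition cardinal_p :: "nat set rel" where
  "cardinal_p = (SOME r. (\<exists>F. centered_no_pseudo F \<and> r = |F| ) \<and>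
                    (\<forall>F. centered_no_pseudo F \<longrightarrow> r \<le>o |F| ))"

definition cardinal_c :: "real rel" where
  "cardinal_c = |UNIV :: real set|"

definition continuum_hypothesis :: bool where
  "continuum_hypothesis \<longleftrightarrow> cardinal_c =o cardSuc natLeq"

lemma centered_no_pseudo_exists: "\<exists>F. centered_no_pseudo F"
proof -
  define x where "x c = fst (prod_decode c)" for c
  define y where "y c = snd (prod_decode c)" for c
  define A where "A n = {c. n \<le> x c}" for n
  define B where "B f = {c. f (x c) \<le> y c}" for f :: "nat \<Rightarrow> nat"
  define F where "F = range A \<union> range B"
  have inf: "infinite {c. N \<le> x c \<and> y c = g (x c)}" for N g
  proof -
    have "inj_on (\<lambda>m. prod_encode (m, g m)) {N..}"
      by (auto intro!: inj_onI)
    then have "infinite ((\<lambda>m. prod_encode (m, g m)) ` {N..})"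
      using finite_imageD infinite_Ici by blast
    moreover have "(\<lambda>m. prod_encode (m, g m)) ` {N..} \<subseteq> {c. N \<le> x c \<and> y c = g (x c)}"
      by (auto simp: x_def y_def)
    ultimately show ?thesis
      using finite_subset by blast
  qed
  have fin: "\<exists>N g. {c. N \<le> x c \<and> g (x c) \<le> y c} \<subseteq> \<Inter>G" if "finite G" "G \<subseteq> F" for G
    using that
  proof (induction G rule: finite_induct)
    case empty
    then show ?case by simp
  next
    case (insert S G)
    then obtain N g where Ng: "{c. N \<le> x c \<and> g (x c) \<le> y c} \<subseteq> \<Inter>G" by auto
    from insert.prems consider n where "S = A n" | f where "S = B f"
      by (auto simp: F_def)
    then show ?case
    proof cases
      case 1
      then have "{c. max n N \<le> x c \<and> g (x c) \<le> y c} \<subseteq> \<Inter>(insert S G)"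
        using Ng by (auto simp: A_def)
      then show ?thesis by blast
    next
      case 2
      then have "{c. N \<le> x c \<and> (\<lambda>m. max (f m) (g m)) (x c) \<le> y c} \<subseteq> \<Inter>(insert S G)"
        using Ng by (auto simp: B_def)
      then show ?thesis by (intro exI)
    qed
  qed
  have sub: "\<exists>P. infinite P \<and> P \<subseteq> \<Inter>G" if G: "finite G" "G \<subseteq> F" for G
  proof -
    obtain N g where Ng: "{c. N \<le> x c \<and> g (x c) \<le> y c} \<subseteq> \<Inter>G"
      using fin[OF G] by blast
    have "{c. N \<le> x c \<and> y c = g (x c)} \<subseteq> {c. N \<le> x c \<and> g (x c) \<le> y c}" by auto
    with Ng inf[of N g] show ?thesis by blast
  qed
  have "centered F"
    unfolding centered_def
  proof (intro conjI ballI allI impI)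
    fix S assume "S \<in> F"
    then obtain P where "infinite P" "P \<subseteq> S"
      using sub[of "{S}"] by auto
    then show "infinite S"
      using finite_subset by blast
  next
    fix G assume "finite G \<and> G \<subseteq> F"
    then obtain P where P: "infinite P" "P \<subseteq> \<Inter>G" using sub by blast
    have "finite (P - S)" if "S \<in> G" for S
    proof -
      have "P - S = {}" using P that by auto
      then show ?thesis by (metis finite.emptyI)
    qed
    then have "pseudointersection G P"
      using P(1) unfolding pseudointersection_def almost_subset_def by blast
    then show "\<exists>P. pseudointersection G P" ..
  qed
  moreover have "\<not> pseudointersection F P" for P
  proof
    assume P: "pseudointersection F P"
    have col: "finite {c \<in> P. x c = m}" for m
    proof (rule finite_subset)
      show "{c \<in> P. x c = m} \<subseteq> P - A (Suc m)" by (auto simp: A_def)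
      show "finite (P - A (Suc m))"
        using P by (auto simp: pseudointersection_def almost_subset_def F_def)
    qed
    define f where "f m = Suc (\<Sum>c\<in>{c \<in> P. x c = m}. y c)" for m
    have "P - B f = P"
    proof -
      have "y c < f (x c)" if "c \<in> P" for c
        using member_le_sum[of c "{d \<in> P. x d = x c}" y] col[of "x c"] that
        by (simp add: f_def)
      then show ?thesis by (force simp: B_def)
    qed
    moreover have "finite (P - B f)" "infinite P"
      using P by (auto simp: pseudointersection_def almost_subset_def F_def)
    ultimately show False by simp
  qed
  ultimately show ?thesis
    unfolding centered_no_pseudo_def by blast
qed

lemma cardinal_p_properties:
  shows cardinal_p_attained: "\<exists>F. centered_no_pseudo F \<and> cardinal_p = |F|"
    and cardinal_p_least: "\<And>F. centered_no_pseudo F \<Longrightarrow> cardinal_p \<le>o |F|"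
proof -
  let ?R = "card_of ` {F. centered_no_pseudo F}"
  have "?R \<noteq> {}" using centered_no_pseudo_exists by auto
  moreover have "\<forall>r\<in>?R. Card_order r" using card_of_Card_order by blast
  ultimately have "\<exists>r\<in>?R. \<forall>r'\<in>?R. r \<le>o r'" by (rule exists_minim_Card_order)
  then have "\<exists>r. (\<exists>F. centered_no_pseudo F \<and> r = |F| ) \<and>
               (\<forall>F. centered_no_pseudo F \<longrightarrow> r \<le>o |F| )" by blast
  from someI_ex[OF this]
  show "\<exists>F. centered_no_pseudo F \<and> cardinal_p = |F|"
    and "\<And>F. centered_no_pseudo F \<Longrightarrow> cardinal_p \<le>o |F|"
    unfolding cardinal_p_def by blast+
qed

end

theory Submission
  imports Defs
begin

text \<open>
  Reals in the unit interval are given by their sets of binary digits, and the digit positions are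
  grouped into the rapidly growing blocks from \<open>fact n\<close> to \<open>fact (n + 1) - 1\<close>. The set \<open>Y\<close>
  consists of the reals that have an expansion in which infinitely many blocks are empty. An empty
  block \<open>n\<close> makes \<open>fact n\<close> digits determine the number up to \<open>fact (n + 1)\<close> digits, so \<open>Y\<close> has
  dimension zero (\<open>hausdorff_null_sparse_reals\<close>).

  Let \<open>y\<close> be any infinite set of block numbers. Splitting the digits of a real into those inside
  and those outside the blocks of \<open>y\<close> writes it as the sum of a number supported on \<open>y\<close> and an
  element of \<open>Y\<close>. Therefore \<open>X + Y\<close> contains all \<open>z\<close> with \<open>0 \<le> z < 1\<close> if for each of them
  some infinite \<open>y\<close> is found for which the part of \<open>z\<close> inside the blocks of \<open>y\<close> belongs to
  \<open>X\<close>. It is this freedom in choosing \<open>y\<close> that is compatible with \<open>X\<close> being a \<open>\<gamma>\<close>-set. The points of \<open>X\<close> are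
  constructed by a transfinite recursion of length continuum, along a tower of infinite sets \<open>y\<close>
  that decreases modulo finite sets, starting from the countable set of dyadic numbers with finitely
  many digits. At each stage one potential \<open>\<omega>\<close>-cover is treated: by the argument of Galvin and
  Miller (\<open>capture_on_subset\<close>) the current \<open>y\<close> can be thinned out so that a sequence of members of
  the cover eventually contains each point constructed so far and also each number whose digits lie,
  up to finitely many, in the blocks of \<open>y\<close>. All later points are of the latter kind. Each
  stage of the recursion, and that argument as well, needs a pseudointersection of a centered family
  of size less than the continuum, and this is what the set-theoretic hypothesis provides.

  Since \<open>X + Y\<close> is a bounded set of reals that contains an interval of length 1, its
  dimension is 1, and it is the image of \<open>X \<times> Y\<close> under addition, a Lipschitz map. Lipschitz maps do not increase Hausdorff
  dimension.
\<close>

section \<open>Bounds for the Hausdorff dimension\<close>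

text \<open>
  For \<open>\<delta> > 0\<close> this is the vanishing of the \<open>\<delta>\<close>-dimensional Hausdorff measure of \<open>Z\<close>: a small
  sum already forces every single diameter to be small.
\<close>

definition hausdorff_null :: "real \<Rightarrow> 'a::euclidean_space set \<Rightarrow> bool" where
  "hausdorff_null \<delta> Z \<longleftrightarrow> (\<forall>\<epsilon>::real. \<epsilon> > 0 \<longrightarrow>
     (\<exists>I :: nat \<Rightarrow> 'a set. Z \<subseteq> (\<Union>n. I n) \<and> (\<forall>n. bounded (I n)) \<and>
        summable (\<lambda>n. diameter (I n) powr \<delta>) \<and> (\<Sum>n. diameter (I n) powr \<delta>) < \<epsilon>))"

lemma hausdorff_dim_altdef:
  "hausdorff_dim Z = Inf {ereal \<delta> | \<delta>. \<delta> > 0 \<and> hausdorff_null \<delta> Z}"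
  by (simp add: hausdorff_dim_def hausdorff_null_def)

lemma hausdorff_dim_geI:
  assumes "\<And>\<delta>. 0 < \<delta> \<Longrightarrow> hausdorff_null \<delta> Z \<Longrightarrow> s \<le> \<delta>"
  shows "ereal s \<le> hausdorff_dim Z"
  unfolding hausdorff_dim_altdef using assms by (auto intro!: Inf_greatest)

lemma hausdorff_dim_leI:
  assumes "0 \<le> s" and null: "\<And>\<delta>. s < \<delta> \<Longrightarrow> hausdorff_null \<delta> Z"
  shows "hausdorff_dim Z \<le> ereal s"
proof (rule ereal_le_epsilon2)
  fix e :: real assume "0 < e"
  then have "hausdorff_dim Z \<le> ereal (s + e)"
    unfolding hausdorff_dim_altdef using assms by (intro Inf_lower) auto
  then show "hausdorff_dim Z \<le> ereal s + ereal e" by simp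
qed

text \<open>
  Concrete covers tend to come in stages, the \<open>n\<close>-th one consisting of \<open>c n\<close> sets of diameter at
  most \<open>d n\<close>. The pairing function on the naturals arranges all stages into the single sequence
  that the definition asks for, and a partial sum of that sequence stays below the partial sum of
  the stages because the stage number never exceeds the code of a pair.
\<close>

lemma hausdorff_nullI_staged:
  fixes Z :: "'a::euclidean_space set"
  assumes covers: "\<And>\<epsilon>::real. \<epsilon> > 0 \<Longrightarrow>
    \<exists>(c :: nat \<Rightarrow> nat) J d. Z \<subseteq> (\<Union>n. \<Union>k<c n. J n k) \<and>
      (\<forall>n k. k < c n \<longrightarrow> bounded (J n k) \<and> diameter (J n k) \<le> d n) \<and>
      (\<forall>M. (\<Sum>n<M. real (c n) * d n powr \<delta>) \<le> \<epsilon>)"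
    and "\<delta> > 0"
  shows "hausdorff_null \<delta> Z"
  unfolding hausdorff_null_def
proof (intro allI impI)
  fix \<epsilon> :: real assume "\<epsilon> > 0"
  then have "\<epsilon> / 2 > 0" by simp
  from covers[OF this] obtain c :: "nat \<Rightarrow> nat" and J d
    where *: "Z \<subseteq> (\<Union>n. \<Union>k<c n. J n k) \<and>
      (\<forall>n k. k < c n \<longrightarrow> bounded (J n k) \<and> diameter (J n k) \<le> d n) \<and>
      (\<forall>M. (\<Sum>n<M. real (c n) * d n powr \<delta>) \<le> \<epsilon> / 2)"
    by blast
  then have cov: "Z \<subseteq> (\<Union>n. \<Union>k<c n. J n k)" by blast
  have J: "bounded (J n k)" "diameter (J n k) \<le> d n" if "k < c n" for n k
    using * that by blast+
  have le: "(\<Sum>n<M. real (c n) * d n powr \<delta>) \<le> \<epsilon> / 2" for M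
    using * by blast
  define I where "I i = (case prod_decode i of (n, k) \<Rightarrow> if k < c n then J n k else {})" for i
  have I_encode: "I (prod_encode (n, k)) = (if k < c n then J n k else {})" for n k
    by (simp add: I_def)
  have "Z \<subseteq> (\<Union>i. I i)"
  proof
    fix z assume "z \<in> Z"
    then obtain n k where "k < c n" "z \<in> J n k" using cov by auto
    then show "z \<in> (\<Union>i. I i)"
      by (intro UN_I[of "prod_encode (n, k)"]) (auto simp: I_encode)
  qed
  moreover have "bounded (I i)" for i
    using J by (auto simp: I_def split: prod.split)
  moreover have part: "(\<Sum>i<M. diameter (I i) powr \<delta>) \<le> \<epsilon> / 2" for M
  proof -
    let ?S = "SIGMA n:{..<M}. {..<c n}"
    have "(\<Sum>i<M. diameter (I i) powr \<delta>) \<le> (\<Sum>i\<in>prod_encode ` ?S. diameter (I i) powr \<delta>)"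
    proof -
      have "(\<Sum>i<M. diameter (I i) powr \<delta>) = (\<Sum>i\<in>{..<M} \<inter> prod_encode ` ?S. diameter (I i) powr \<delta>)"
      proof (rule sum.mono_neutral_right)
        show "\<forall>i\<in>{..<M} - {..<M} \<inter> prod_encode ` ?S. diameter (I i) powr \<delta> = 0"
        proof
        fix i assume "i \<in> {..<M} - {..<M} \<inter> prod_encode ` ?S"
        then have i: "i < M" "i \<notin> prod_encode ` ?S" by auto
        obtain n k where "prod_decode i = (n, k)" by fastforce
        then have "i = prod_encode (n, k)" by (metis prod_decode_inverse)
        moreover from this have "n \<le> i" using le_prod_encode_1 by blast
        ultimately show "diameter (I i) powr \<delta> = 0" using i by (force simp: I_encode)
        qed
      qed auto
      also have "\<dots> \<le> (\<Sum>i\<in>prod_encode ` ?S. diameter (I i) powr \<delta>)"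
        by (intro sum_mono2) auto
      finally show ?thesis .
    qed
    also have "\<dots> = (\<Sum>(n, k)\<in>?S. diameter (J n k) powr \<delta>)"
      by (subst sum.reindex) (auto intro!: sum.cong simp: I_encode inj_on_def)
    also have "\<dots> = (\<Sum>n<M. \<Sum>k<c n. diameter (J n k) powr \<delta>)"
      by (subst sum.Sigma) auto
    also have "\<dots> \<le> (\<Sum>n<M. \<Sum>k<c n. d n powr \<delta>)"
      using J \<open>\<delta> > 0\<close> by (intro sum_mono powr_mono2) (auto intro: diameter_ge_0)
    also have "\<dots> = (\<Sum>n<M. real (c n) * d n powr \<delta>)" by simp
    also have "\<dots> \<le> \<epsilon> / 2" by (rule le)
    finally show ?thesis .
  qed
  moreover have "summable (\<lambda>i. diameter (I i) powr \<delta>)"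
    by (rule summableI_nonneg_bounded[OF _ part]) simp
  moreover have "(\<Sum>i. diameter (I i) powr \<delta>) \<le> \<epsilon> / 2"
    using calculation(4) part by (rule suminf_le_const)
  ultimately show "\<exists>I. Z \<subseteq> (\<Union>n. I n) \<and> (\<forall>n. bounded (I n)) \<and>
        summable (\<lambda>n. diameter (I n) powr \<delta>) \<and> (\<Sum>n. diameter (I n) powr \<delta>) < \<epsilon>"
    using \<open>\<epsilon> > 0\<close> by (intro exI[of _ I]) auto
qed

lemma hausdorff_null_lipschitz_image:
  fixes f :: "'a::euclidean_space \<Rightarrow> 'b::euclidean_space"
  assumes lip: "L-lipschitz_on Z f" and null: "hausdorff_null \<delta> Z" and "0 < \<delta>"
  shows "hausdorff_null \<delta> (f ` Z)"
  unfolding hausdorff_null_def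
proof (intro allI impI)
  fix \<epsilon> :: real assume "\<epsilon> > 0"
  \<comment> \<open>The summand 1 keeps \<open>C\<close> positive when the Lipschitz constant is 0.\<close>
  define C where "C = (L + 1) powr \<delta>"
  have "L \<ge> 0" using lip by (rule lipschitz_on_nonneg)
  then have "C > 0" by (simp add: C_def)
  then have "\<epsilon> / C > 0" using \<open>\<epsilon> > 0\<close> by simp
  then obtain I where I: "Z \<subseteq> (\<Union>n. I n)" "\<And>n. bounded (I n)"
      "summable (\<lambda>n. diameter (I n) powr \<delta>)" "(\<Sum>n. diameter (I n) powr \<delta>) < \<epsilon> / C"
    using null unfolding hausdorff_null_def by blast
  define K where "K n = f ` (I n \<inter> Z)" for n
  have dist: "dist (f x) (f y) \<le> (L + 1) * diameter (I n)" if "x \<in> I n \<inter> Z" "y \<in> I n \<inter> Z" for x y n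
  proof -
    have "dist (f x) (f y) \<le> L * dist x y" using lip that by (auto dest: lipschitz_onD)
    also have "\<dots> \<le> (L + 1) * diameter (I n)"
      using that I(2) \<open>L \<ge> 0\<close> by (intro mult_mono diameter_bounded_bound) auto
    finally show ?thesis .
  qed
  have bdd: "bounded (K n)" for n
    unfolding K_def bounded_two_points using dist by blast
  have "diameter (K n) \<le> (L + 1) * diameter (I n)" for n
    using dist \<open>L \<ge> 0\<close> diameter_ge_0[OF I(2)[of n]]
    by (intro diameter_le) (auto simp: K_def dist_norm)
  then have "diameter (K n) powr \<delta> \<le> ((L + 1) * diameter (I n)) powr \<delta>" for n
    using \<open>0 < \<delta>\<close> bdd by (intro powr_mono2) (auto intro: diameter_ge_0)
  then have le: "diameter (K n) powr \<delta> \<le> C * diameter (I n) powr \<delta>" for n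
    using \<open>L \<ge> 0\<close> I(2) by (simp add: C_def powr_mult diameter_ge_0)
  have sC: "summable (\<lambda>n. C * diameter (I n) powr \<delta>)" using I(3) by (rule summable_mult)
  have sK: "summable (\<lambda>n. diameter (K n) powr \<delta>)"
    by (rule summable_comparison_test'[OF sC, of 0]) (use le in auto)
  have "(\<Sum>n. diameter (K n) powr \<delta>) \<le> (\<Sum>n. C * diameter (I n) powr \<delta>)"
    using le sK sC by (intro suminf_le)
  also have "\<dots> = C * (\<Sum>n. diameter (I n) powr \<delta>)" using I(3) by (rule suminf_mult)
  also have "\<dots> < \<epsilon>" using I(4) \<open>C > 0\<close> by (simp add: field_simps)
  finally have "(\<Sum>n. diameter (K n) powr \<delta>) < \<epsilon>" .
  moreover have "f ` Z \<subseteq> (\<Union>n. K n)" using I(1) by (fastforce simp: K_def)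
  ultimately show "\<exists>I. f ` Z \<subseteq> (\<Union>n. I n) \<and> (\<forall>n. bounded (I n)) \<and>
        summable (\<lambda>n. diameter (I n) powr \<delta>) \<and> (\<Sum>n. diameter (I n) powr \<delta>) < \<epsilon>"
    using bdd sK by blast
qed

lemma hausdorff_dim_lipschitz_image:
  fixes f :: "'a::euclidean_space \<Rightarrow> 'b::euclidean_space"
  assumes "L-lipschitz_on Z f"
  shows "hausdorff_dim (f ` Z) \<le> hausdorff_dim Z"
  unfolding hausdorff_dim_altdef using hausdorff_null_lipschitz_image[OF assms]
  by (intro Inf_superset_mono) auto

text \<open>
  A bounded set is covered by a constant multiple of \<open>K\<close> intervals of length \<open>1 / K\<close>, and
  \<open>K * (1 / K) powr \<delta>\<close> tends to 0 when \<open>\<delta> > 1\<close>.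
\<close>

lemma hausdorff_dim_bounded_real_le_1:
  fixes Z :: "real set"
  assumes "bounded Z"
  shows "hausdorff_dim Z \<le> 1"
proof -
  obtain a where a: "a > 0" "\<And>x. x \<in> Z \<Longrightarrow> \<bar>x\<bar> \<le> a"
    using assms unfolding bounded_pos by auto
  define l where "l = nat \<lceil>a\<rceil>"
  have l: "x \<in> Z \<Longrightarrow> \<bar>x\<bar> \<le> real l" for x using a(2)[of x] unfolding l_def by linarith
  have "hausdorff_null \<delta> Z" if \<delta>: "1 < \<delta>" for \<delta>
  proof (rule hausdorff_nullI_staged)
    fix \<epsilon> :: real assume "\<epsilon> > 0"
    have "((\<lambda>K. real K powr (1 - \<delta>)) \<longlongrightarrow> 0) sequentially"
      using \<delta> by (intro tendsto_neg_powr filterlim_real_sequentially) auto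
    then have "((\<lambda>K. (2 * real l + 1) * real K powr (1 - \<delta>)) \<longlongrightarrow> 0) sequentially"
      using tendsto_mult_right_zero by blast
    then have "\<forall>\<^sub>F K in sequentially. (2 * real l + 1) * real K powr (1 - \<delta>) < \<epsilon>"
      using \<open>\<epsilon> > 0\<close> by (rule order_tendstoD)
    then obtain K where K: "K \<ge> 1" "(2 * real l + 1) * real K powr (1 - \<delta>) < \<epsilon>"
      using eventually_conj[OF _ eventually_ge_at_top[of "1::nat"]] eventually_happens'
      by (metis (no_types, lifting) sequentially_bot)
    define c where "c n = (if n = 0 then (2 * l + 1) * K else 0)" for n :: nat
    define J where "J n k = {real k / K - l .. (real k + 1) / K - l}" for n k :: nat
    have "x \<in> (\<Union>n. \<Union>k<c n. J n k)" if "x \<in> Z" for x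
    proof -
      define k where "k = nat \<lfloor>(x + l) * K\<rfloor>"
      have nn: "0 \<le> (x + l) * K" using l[OF that] by (intro mult_nonneg_nonneg) auto
      then have k: "real k \<le> (x + l) * K" "(x + l) * K < real k + 1"
        unfolding k_def by linarith+
      have "(x + l) * K \<le> (2 * real l) * K" using l[OF that] by (intro mult_right_mono) auto
      also have "\<dots> < real ((2 * l + 1) * K)" using K(1) by (simp add: algebra_simps)
      finally have "real k < real ((2 * l + 1) * K)" using k(1) by linarith
      then have "k < (2 * l + 1) * K" by (simp only: of_nat_less_iff)
      moreover have "x \<in> J 0 k"
        using k K(1) by (simp add: J_def field_simps)
      ultimately show ?thesis by (intro UN_I[of 0] UN_I[of k]) (auto simp: c_def)
    qed
    moreover have "bounded (J n k) \<and> diameter (J n k) \<le> 1 / K" for n k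
      using K(1) by (auto simp: J_def field_simps)
    moreover have "(\<Sum>n<M. real (c n) * (1 / K) powr \<delta>) \<le> \<epsilon>" for M
    proof -
      have "(\<Sum>n<M. real (c n) * (1 / K) powr \<delta>) \<le> (\<Sum>n\<in>{0::nat}. real (c n) * (1 / K) powr \<delta>)"
        by (cases M) (simp_all add: c_def sum.lessThan_Suc_shift del: sum.lessThan_Suc)
      also have "\<dots> = (2 * real l + 1) * real K powr (1 - \<delta>)"
        using K(1) by (simp add: c_def powr_diff powr_divide algebra_simps)
      finally show ?thesis using K(2) by simp
    qed
    ultimately show "\<exists>(c :: nat \<Rightarrow> nat) J d. Z \<subseteq> (\<Union>n. \<Union>k<c n. J n k) \<and>
      (\<forall>n k. k < c n \<longrightarrow> bounded (J n k) \<and> diameter (J n k) \<le> d n) \<and>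
      (\<forall>M. (\<Sum>n<M. real (c n) * d n powr \<delta>) \<le> \<epsilon>)"
      by (intro exI[of _ c] exI[of _ J] exI[of _ "\<lambda>_::nat. 1 / K"]) auto
  qed (use \<delta> in simp)
  then show ?thesis using hausdorff_dim_leI[of 1 Z] by (simp add: one_ereal_def)
qed

text \<open>
  If \<open>\<delta> < 1\<close>, then a set of diameter below 1 satisfies \<open>diameter \<le> diameter powr \<delta>\<close>, so a cover
  with a small \<open>\<delta>\<close>-sum has small total length. Countable subadditivity of Lebesgue measure rules
  this out for the unit interval.
\<close>

lemma hausdorff_dim_ge_1_if_contains_interval:
  fixes Z :: "real set"
  assumes "{0..<1} \<subseteq> Z"
  shows "1 \<le> hausdorff_dim Z"
proof -
  have "1 \<le> \<delta>" if \<delta>: "0 < \<delta>" "hausdorff_null \<delta> Z" for \<delta>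
  proof (rule ccontr)
    assume "\<not> 1 \<le> \<delta>"
    have "(1 :: real) / 2 > 0" by simp
    with \<delta>(2) obtain I :: "nat \<Rightarrow> real set" where I: "Z \<subseteq> (\<Union>n. I n)" "\<And>n. bounded (I n)"
      and summ: "summable (\<lambda>n. diameter (I n) powr \<delta>)"
      and small: "(\<Sum>n. diameter (I n) powr \<delta>) < 1 / 2"
      unfolding hausdorff_null_def by blast
    have nn: "0 \<le> diameter (I n)" for n using I(2) by (rule diameter_ge_0)
    have le: "diameter (I n) \<le> diameter (I n) powr \<delta>" for n
    proof -
      have "diameter (I n) powr \<delta> \<le> (\<Sum>n. diameter (I n) powr \<delta>)"
        using sum_le_suminf[OF summ, of "{n}"] by simp
      then have "diameter (I n) powr \<delta> < 1 powr \<delta>" using small by simp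
      then have "diameter (I n) < 1"
        using \<delta>(1) powr_mono2[of \<delta> 1 "diameter (I n)"] by (cases "diameter (I n) < 1") auto
      then show ?thesis
        using powr_mono'[of \<delta> 1 "diameter (I n)"] nn \<open>\<not> 1 \<le> \<delta>\<close> by simp
    qed
    have sd: "summable (\<lambda>n. diameter (I n))"
      by (rule summable_comparison_test'[OF summ, of 0]) (use le nn in auto)
    \<comment> \<open>A set of diameter \<open>d\<close> lies in an interval of length \<open>2 * d\<close> around any of its points; the
      factor 2 is why the sum was chosen below \<open>1 / 2\<close>.\<close>
    define p where "p n = (SOME x. x \<in> I n)" for n
    define B where "B n = {p n - diameter (I n) .. p n + diameter (I n)}" for n
    have "I n \<subseteq> B n" for n
    proof
      fix x assume x: "x \<in> I n"
      then have "p n \<in> I n" unfolding p_def by (rule someI)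
      then have "dist x (p n) \<le> diameter (I n)" using x I(2) by (intro diameter_bounded_bound)
      then show "x \<in> B n" by (auto simp: B_def dist_real_def)
    qed
    then have "{0..<1} \<subseteq> (\<Union>n. B n)" using I(1) assms by (meson UN_mono order_trans subset_UNIV)
    moreover have B: "B n \<in> sets lborel" for n by (simp add: B_def)
    ultimately have "emeasure lborel {0..<1::real} \<le> emeasure lborel (\<Union>n. B n)"
      by (intro emeasure_mono sets.countable_UN) auto
    also have "\<dots> \<le> (\<Sum>n. emeasure lborel (B n))"
      using B by (intro emeasure_subadditive_countably) auto
    also have "\<dots> = (\<Sum>n. ennreal (2 * diameter (I n)))"
      using nn by (simp add: B_def)
    also have "\<dots> = ennreal (\<Sum>n. 2 * diameter (I n))"
      using nn sd by (intro suminf_ennreal2 summable_mult) auto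
    also have "(\<Sum>n. 2 * diameter (I n)) = 2 * (\<Sum>n. diameter (I n))"
      using sd by (rule suminf_mult)
    also have "(\<Sum>n. diameter (I n)) \<le> (\<Sum>n. diameter (I n) powr \<delta>)"
      using le sd summ by (intro suminf_le)
    finally have "ennreal 1 \<le> ennreal (2 * (\<Sum>n. diameter (I n) powr \<delta>))"
      by (simp add: ennreal_leI)
    then show False using small by (simp add: ennreal_le_iff2)
  qed
  then show ?thesis using hausdorff_dim_geI[of Z 1] by (simp add: one_ereal_def)
qed

section \<open>Binary expansions\<close>

definition binary_value :: "nat set \<Rightarrow> real" where
  "binary_value A = (\<Sum>n. indicator A n * (1/2) ^ Suc n)"

lemma summable_binary: "summable (\<lambda>n. indicator A n * (1/2 :: real) ^ Suc n)"
proof (rule summable_comparison_test'[where N=0])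
  show "summable (\<lambda>n. (1/2 :: real) ^ Suc n)"
    by (intro summable_Suc_iff[THEN iffD2] summable_geometric) simp
qed (auto simp: indicator_def)

lemma binary_value_Un_disjoint:
  assumes "A \<inter> B = {}"
  shows "binary_value (A \<union> B) = binary_value A + binary_value B"
proof -
  have "indicator (A \<union> B) n * (1/2 :: real) ^ Suc n =
      indicator A n * (1/2) ^ Suc n + indicator B n * (1/2) ^ Suc n" for n
    using assms by (auto simp: indicator_def)
  then show ?thesis
    unfolding binary_value_def by (simp only: suminf_add[OF summable_binary summable_binary])
qed

lemma binary_value_split: "binary_value A = binary_value (A \<inter> B) + binary_value (A - B)"
proof -
  have "binary_value A = binary_value ((A \<inter> B) \<union> (A - B))" by (simp add: Int_Diff_Un)
  also have "\<dots> = binary_value (A \<inter> B) + binary_value (A - B)"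
    by (intro binary_value_Un_disjoint) auto
  finally show ?thesis .
qed

lemma binary_value_nonneg: "0 \<le> binary_value A"
  unfolding binary_value_def by (intro suminf_nonneg summable_binary) simp

lemma binary_value_tail_le:
  assumes "A \<subseteq> {n..}"
  shows "binary_value A \<le> (1/2) ^ n"
proof -
  have sums: "(\<lambda>i. (1/2 :: real) ^ Suc (i + n)) sums (1/2) ^ n"
    using sums_mult[OF power_half_series, of "(1/2) ^ n"] by (simp add: power_add algebra_simps)
  have "binary_value A = (\<Sum>i. indicator A (i + n) * (1/2) ^ Suc (i + n))
      + (\<Sum>i<n. indicator A i * (1/2) ^ Suc i)"
    unfolding binary_value_def by (rule suminf_split_initial_segment[OF summable_binary])
  also have "(\<Sum>i<n. indicator A i * (1/2 :: real) ^ Suc i) = 0"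
    using assms by (intro sum.neutral) (auto simp: indicator_def)
  also have "(\<Sum>i. indicator A (i + n) * (1/2 :: real) ^ Suc (i + n)) \<le> (\<Sum>i. (1/2) ^ Suc (i + n))"
    using summable_ignore_initial_segment[OF summable_binary, of A n] sums
    by (intro suminf_le) (auto simp: indicator_def sums_iff)
  also have "\<dots> = (1/2) ^ n" using sums by (simp add: sums_iff)
  finally show ?thesis by simp
qed

lemma binary_value_le_1: "binary_value A \<le> 1"
  using binary_value_tail_le[of A 0] by simp

lemma floor_double: "\<lfloor>2 * x :: real\<rfloor> = 2 * \<lfloor>x\<rfloor> + (if odd \<lfloor>2 * x\<rfloor> then 1 else 0)"
proof -
  have "\<lfloor>2 * x\<rfloor> = 2 * \<lfloor>x\<rfloor> \<or> \<lfloor>2 * x\<rfloor> = 2 * \<lfloor>x\<rfloor> + 1" by linarith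
  then show ?thesis by auto
qed

lemma binary_value_surj:
  assumes "0 \<le> x" "x < 1"
  shows "\<exists>A. binary_value A = x"
proof -
  define A where "A = {n. odd \<lfloor>x * 2 ^ Suc n\<rfloor>}"
  have part: "(\<Sum>i<n. indicator A i * (1/2) ^ Suc i) = \<lfloor>x * 2 ^ n\<rfloor> / 2 ^ n" for n
  proof (induction n)
    case 0
    then show ?case using assms by (simp add: floor_eq_iff)
  next
    case (Suc n)
    have "\<lfloor>x * 2 ^ Suc n\<rfloor> = 2 * \<lfloor>x * 2 ^ n\<rfloor> + (if n \<in> A then 1 else 0)"
      using floor_double[of "x * 2 ^ n"] by (simp add: A_def mult.left_commute)
    then have "real_of_int \<lfloor>x * 2 ^ Suc n\<rfloor> = 2 * real_of_int \<lfloor>x * 2 ^ n\<rfloor> + indicator A n"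
      by (simp add: indicator_def)
    then show ?case
      using Suc by (simp add: field_simps)
  qed
  have "(\<lambda>n. \<lfloor>x * 2 ^ n\<rfloor> / 2 ^ n) \<longlonglongrightarrow> x"
  proof (rule tendsto_sandwich)
    show "(\<lambda>n. x - (1/2) ^ n) \<longlonglongrightarrow> x"
      by (rule tendsto_eq_intros LIMSEQ_realpow_zero | simp)+
    show "\<forall>\<^sub>F n in sequentially. x - (1/2) ^ n \<le> \<lfloor>x * 2 ^ n\<rfloor> / 2 ^ n"
    proof (intro always_eventually allI)
      fix n
      have "x * 2 ^ n - 1 \<le> \<lfloor>x * 2 ^ n\<rfloor>" by linarith
      then have "(x * 2 ^ n - 1) / 2 ^ n \<le> \<lfloor>x * 2 ^ n\<rfloor> / 2 ^ n"
        by (rule divide_right_mono) simp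
      then show "x - (1/2) ^ n \<le> \<lfloor>x * 2 ^ n\<rfloor> / 2 ^ n"
        by (simp add: diff_divide_distrib power_one_over)
    qed
    show "\<forall>\<^sub>F n in sequentially. \<lfloor>x * 2 ^ n\<rfloor> / 2 ^ n \<le> x"
      by (intro always_eventually allI) (simp add: divide_le_eq)
  qed auto
  then have "(\<lambda>n. indicator A n * (1/2) ^ Suc n) sums x"
    by (simp only: sums_def part)
  then show ?thesis by (auto simp: binary_value_def sums_iff)
qed

section \<open>A dimension-zero set of reals with gaps in their expansion\<close>

text \<open>
  Consecutive intervals of coordinates. The ratio of the endpoints tends to infinity, which is what
  makes a real with infinitely many empty blocks so well approximable. Coordinate 0 lies in no
  block.
\<close>

definition block :: "nat \<Rightarrow> nat set" where
  "block n = {fact n..<fact (Suc n)}"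

definition sparse_reals :: "real set" where
  "sparse_reals = {binary_value A | A. \<exists>\<^sub>\<infinity>n. A \<inter> block n = {}}"

lemma sum_powers_of_half_from:
  "(\<Sum>n<M. if N \<le> n then (1/2 :: real) ^ n else 0) \<le> 2 * (1/2) ^ N"
proof -
  have "(\<Sum>n<M. if N \<le> n then (1/2 :: real) ^ n else 0)
      = (if N \<le> M then 2 * (1/2) ^ N - 2 * (1/2) ^ M else 0)"
    by (induction M) (auto simp: le_Suc_eq)
  then show ?thesis by simp
qed

text \<open>
  If \<open>A\<close> misses block \<open>n\<close>, then its first \<open>fact n\<close> digits determine \<open>binary_value A\<close> up to an
  error of \<open>(1/2) ^ fact (Suc n)\<close>. So \<open>2 ^ fact n\<close> intervals of that length are enough for all
  such \<open>A\<close>. As \<open>fact (Suc n)\<close> is \<open>n + 1\<close> times \<open>fact n\<close>, the sum of their \<open>\<delta>\<close>-th powers is at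
  most \<open>(1/2) ^ n\<close> as soon as \<open>\<delta> * (n + 1) \<ge> 2\<close>, and since infinitely many \<open>n\<close> are
  available for each \<open>A\<close>, the stages before any given \<open>N\<close> can be dropped from the cover.
\<close>

lemma hausdorff_null_sparse_reals:
  assumes "\<delta> > 0"
  shows "hausdorff_null \<delta> sparse_reals"
proof (rule hausdorff_nullI_staged)
  fix \<epsilon> :: real assume "\<epsilon> > 0"
  have "(\<lambda>n. 2 * (1/2 :: real) ^ n) \<longlonglongrightarrow> 0"
    by (rule tendsto_eq_intros LIMSEQ_realpow_zero | simp)+
  then have "\<forall>\<^sub>F n in sequentially. 2 * (1/2) ^ n < \<epsilon>"
    using \<open>\<epsilon> > 0\<close> by (rule order_tendstoD)
  then have "\<forall>\<^sub>F n in sequentially. 2 * (1/2) ^ n < \<epsilon> \<and> 2 / \<delta> \<le> real n"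
    using eventually_ge_at_top[of "nat \<lceil>2 / \<delta>\<rceil>"] by eventually_elim linarith
  then obtain N where N: "2 * (1/2) ^ N < \<epsilon>" "2 / \<delta> \<le> real N"
    using eventually_happens'[OF sequentially_bot] by blast
  define c where "c n = (if N \<le> n then 2 ^ fact n else 0 :: nat)" for n :: nat
  define d where "d n = (1/2 :: real) ^ fact (Suc n)" for n :: nat
  define J where "J n k = {binary_value (set_decode k) .. binary_value (set_decode k) + d n}" for n k
  have "x \<in> (\<Union>n. \<Union>k<c n. J n k)" if "x \<in> sparse_reals" for x
  proof -
    obtain A where A: "x = binary_value A" "\<exists>\<^sub>\<infinity>n. A \<inter> block n = {}"
      using \<open>x \<in> sparse_reals\<close> by (auto simp: sparse_reals_def)
    then obtain n where n: "N \<le> n" "A \<inter> block n = {}" by (auto simp: INFM_nat_le)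
    define k where "k = set_encode (A \<inter> {..<fact n})"
    have "k \<le> (\<Sum>i<fact n. 2 ^ i)"
      unfolding k_def set_encode_def by (intro sum_mono2) auto
    also have "\<dots> < 2 ^ fact n" by (simp add: sum_power2 lessThan_atLeast0)
    finally have "k < c n" using n by (simp add: c_def)
    moreover have "A - {..<fact n} \<subseteq> {fact (Suc n)..}"
      using n by (auto simp: block_def disjoint_iff not_less)
    then have "binary_value (A - {..<fact n}) \<le> d n"
      unfolding d_def by (rule binary_value_tail_le)
    then have "x \<in> J n k"
      using binary_value_split[of A "{..<fact n}"] binary_value_nonneg[of "A - {..<fact n}"]
      by (simp add: J_def A(1) k_def)
    ultimately show ?thesis by blast
  qed
  moreover have "bounded (J n k)" "diameter (J n k) \<le> d n" for n k
    by (auto simp: J_def d_def)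
  moreover have "(\<Sum>n<M. real (c n) * d n powr \<delta>) \<le> \<epsilon>" for M
  proof -
    have "real (c n) * d n powr \<delta> \<le> (if N \<le> n then (1/2) ^ n else 0)" for n
    proof (cases "N \<le> n")
      case True
      have "2 / \<delta> \<le> real n" using True N(2) by linarith
      then have "2 \<le> \<delta> * real (Suc n)" using assms by (simp add: field_simps)
      then have "2 * fact n \<le> (\<delta> * real (Suc n)) * (fact n :: real)"
        by (intro mult_right_mono) auto
      then have le: "2 * fact n \<le> \<delta> * (fact (Suc n) :: real)" by (simp add: algebra_simps)
      have "real n \<le> fact n" using fact_ge_self[of n] by (metis of_nat_fact of_nat_le_iff)
      have "real (c n) = 2 powr fact n"
        using True powr_realpow[of 2 "fact n"] by (simp add: c_def)
      moreover have "d n = 2 powr (- fact (Suc n))"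
        using powr_realpow[of 2 "fact (Suc n)"]
        by (simp add: d_def powr_minus power_one_over inverse_eq_divide del: fact_Suc)
      ultimately have "real (c n) * d n powr \<delta> = 2 powr (fact n + - fact (Suc n) * \<delta>)"
        by (simp only: powr_powr powr_add)
      also have "fact n + - fact (Suc n) * \<delta> \<le> - real n"
        using le \<open>real n \<le> fact n\<close> by (simp add: mult.commute del: fact_Suc)
      then have "2 powr (fact n + - fact (Suc n) * \<delta>) \<le> 2 powr (- real n)"
        by (intro powr_mono) (auto simp del: fact_Suc)
      also have "\<dots> = (1/2) ^ n" by (simp add: powr_minus_divide powr_realpow power_one_over)
      finally show ?thesis using True by simp
    qed (simp add: c_def)
    then have "(\<Sum>n<M. real (c n) * d n powr \<delta>) \<le> (\<Sum>n<M. if N \<le> n then (1/2) ^ n else 0)"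
      by (intro sum_mono)
    then show ?thesis using sum_powers_of_half_from[of N M] N(1) by linarith
  qed
  ultimately show "\<exists>(c :: nat \<Rightarrow> nat) J d. sparse_reals \<subseteq> (\<Union>n. \<Union>k<c n. J n k) \<and>
      (\<forall>n k. k < c n \<longrightarrow> bounded (J n k) \<and> diameter (J n k) \<le> d n) \<and>
      (\<forall>M. (\<Sum>n<M. real (c n) * d n powr \<delta>) \<le> \<epsilon>)"
    by (intro exI[of _ c] exI[of _ J] exI[of _ d]) auto
qed (fact assms)

lemma hausdorff_dim_sparse_reals: "hausdorff_dim sparse_reals = 0"
proof (rule antisym)
  show "hausdorff_dim sparse_reals \<le> 0"
    using hausdorff_dim_leI[OF order_refl hausdorff_null_sparse_reals] by (simp add: zero_ereal_def)
  show "0 \<le> hausdorff_dim sparse_reals"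
    using hausdorff_dim_geI[of sparse_reals 0] by (simp add: zero_ereal_def)
qed

section \<open>Pseudointersections of small centered families\<close>

text \<open>
  The classical diagonal argument: finite intersections are infinite, so a strictly increasing
  sequence can be chosen whose \<open>n\<close>-th term lies in the first \<open>n + 1\<close> members of the family.
\<close>

lemma countable_centered_has_pseudointersection:
  assumes "countable F" "centered F"
  shows "\<exists>P. pseudointersection F P"
proof (cases "F = {}")
  case True
  then show ?thesis by (auto simp: pseudointersection_def intro!: exI[of _ UNIV])
next
  case False
  define B where "B = from_nat_into F"
  have B: "range B = F" unfolding B_def using False assms(1) by (rule range_from_nat_into)
  have inf: "infinite (\<Inter>i\<le>n. B i)" for n
  proof -
    have "finite (B ` {..n})" "B ` {..n} \<subseteq> F" using B by auto
    then obtain P where P: "pseudointersection (B ` {..n}) P"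
      using assms(2) unfolding centered_def by blast
    then have "finite (\<Union>i\<le>n. P - B i)"
      by (intro finite_UN_I) (auto simp: pseudointersection_def almost_subset_def)
    moreover have "P \<subseteq> (\<Union>i\<le>n. P - B i) \<union> (\<Inter>i\<le>n. B i)" by blast
    ultimately show ?thesis
      using P finite_subset unfolding pseudointersection_def by (metis finite_UnI)
  qed
  have "\<exists>s. \<forall>n. s n \<in> (\<Inter>i\<le>n. B i) \<and> s n < s (Suc n)"
  proof (rule dependent_nat_choice)
    show "\<exists>k. k \<in> (\<Inter>i\<le>0. B i)" using inf[of 0] by (metis ex_in_conv finite.emptyI)
    show "\<exists>l. l \<in> (\<Inter>i\<le>Suc n. B i) \<and> k < l" for k n
      using inf[of "Suc n"] unfolding infinite_nat_iff_unbounded by blast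
  qed
  then obtain s where s: "\<And>n. s n \<in> (\<Inter>i\<le>n. B i)" "\<And>n. s n < s (Suc n)" by blast
  have inj: "inj s" using s(2) strict_mono_imp_inj_on strict_mono_Suc_iff by blast
  have "finite (range s - B n)" for n
  proof (rule finite_subset)
    have "i < n" if "s i \<notin> B n" for i using s(1)[of i] that by (cases "i < n") auto
    then show "range s - B n \<subseteq> s ` {..<n}" by blast
  qed simp
  then have "pseudointersection F (range s)"
    using inj B range_inj_infinite by (auto simp: pseudointersection_def almost_subset_def)
  then show ?thesis ..
qed

lemma nat_ordLess_real: "|UNIV :: nat set| <o |UNIV :: real set|"
proof -
  have "\<not> |UNIV :: real set| \<le>o |UNIV :: nat set|"
    using uncountable_UNIV_real unfolding card_of_ordLeq[symmetric] countable_def by blast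
  then show ?thesis by (simp add: not_ordLeq_iff_ordLess[OF card_of_Well_order card_of_Well_order])
qed

text \<open>
  The only consequence of the set-theoretic hypothesis that the construction uses. Under the
  Continuum Hypothesis a family of size less than the continuum is countable; under \<open>p = c\<close> it is
  smaller than \<open>p\<close>.
\<close>

lemma small_centered_has_pseudointersection:
  assumes hyp: "continuum_hypothesis \<or> cardinal_p =o cardinal_c"
    and F: "centered F" "|F| <o |UNIV :: real set|"
  shows "\<exists>P. pseudointersection F P"
  using hyp
proof
  assume "continuum_hypothesis"
  then have "|UNIV :: real set| =o cardSuc natLeq"
    by (simp add: continuum_hypothesis_def cardinal_c_def)
  with F(2) have "|F| <o cardSuc natLeq" by (rule ordLess_ordIso_trans)
  then have "|F| \<le>o natLeq"
    by (simp add: cardSuc_ordLeq_ordLess natLeq_Card_order card_of_Card_order)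
  then have "|F| \<le>o |UNIV :: nat set|"
    using card_of_nat ordIso_symmetric ordLeq_ordIso_trans by blast
  then have "countable F"
    unfolding card_of_ordLeq[symmetric] countable_def by blast
  then show ?thesis using F(1) by (rule countable_centered_has_pseudointersection)
next
  assume "cardinal_p =o cardinal_c"
  then have "|UNIV :: real set| =o cardinal_p"
    unfolding cardinal_c_def by (rule ordIso_symmetric)
  with F(2) have "|F| <o cardinal_p" by (rule ordLess_ordIso_trans)
  then show ?thesis
    using F(1) cardinal_p_least[of F] not_ordLess_ordLeq unfolding centered_no_pseudo_def by blast
qed

section \<open>Thinning a set of blocks to capture an omega-cover\<close>

text \<open>
  A gap in the digits after position \<open>n\<close> keeps a real close to one of the finitely many dyadic
  numbers with digits below \<open>n\<close>. Being finitely many, these have neighbourhoods in \<open>V\<close> of a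
  common radius.
\<close>

lemma binary_cylinder_neighbourhood:
  assumes "open V" and in_V: "\<And>A. A \<subseteq> {..<n} \<Longrightarrow> binary_value A \<in> V"
  shows "\<exists>m>n. \<forall>A. A \<inter> {n..<m} = {} \<longrightarrow> binary_value A \<in> V"
proof -
  have "\<forall>A\<in>Pow {..<n}. \<exists>e>0. ball (binary_value A) e \<subseteq> V"
    using assms by (meson PowD open_contains_ball)
  then obtain e where e: "\<And>A. A \<subseteq> {..<n} \<Longrightarrow> e A > 0 \<and> ball (binary_value A) (e A) \<subseteq> V"
    by (metis PowI)
  define E where "E = Min (e ` Pow {..<n})"
  have "E > 0" unfolding E_def using e by (subst Min_gr_iff) auto
  have E_le: "E \<le> e A" if "A \<subseteq> {..<n}" for A unfolding E_def using that by (intro Min_le) auto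
  obtain k where k: "(1/2 :: real) ^ k < E" using real_arch_pow_inv[OF \<open>E > 0\<close>, of "1/2"] by auto
  define m where "m = max k (Suc n)"
  have "(1/2 :: real) ^ m \<le> (1/2) ^ k" by (intro power_decreasing) (auto simp: m_def)
  have "binary_value A \<in> V" if A: "A \<inter> {n..<m} = {}" for A
  proof -
    have "A - {..<n} \<subseteq> {m..}" using A by (auto simp: disjoint_iff not_less)
    then have "binary_value (A - {..<n}) \<le> (1/2) ^ m" by (rule binary_value_tail_le)
    also have "\<dots> < e (A \<inter> {..<n})"
      using k E_le[of "A \<inter> {..<n}", OF Int_lower2] \<open>(1/2) ^ m \<le> (1/2) ^ k\<close> by linarith
    finally have "dist (binary_value (A \<inter> {..<n})) (binary_value A) < e (A \<inter> {..<n})"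
      using binary_value_split[of A "{..<n}"] binary_value_nonneg[of "A - {..<n}"]
      by (simp add: dist_real_def)
    then show ?thesis using e[of "A \<inter> {..<n}"] by auto
  qed
  moreover have "n < m" by (simp add: m_def)
  ultimately show ?thesis by blast
qed

definition block_support :: "nat set \<Rightarrow> nat set" where
  "block_support y = (\<Union>n\<in>y. block n)"

definition finite_binaries :: "real set" where
  "finite_binaries = {binary_value A | A. finite A}"

text \<open>
  The \<open>\<omega>\<close>-cover condition for the part of the sequence \<open>G\<close> indexed by \<open>W\<close>. Coding families of
  open sets by sets of naturals makes it possible to enumerate them by the type \<^typ>\<open>nat set\<close>.
\<close>

definition omega_indices :: "(nat \<Rightarrow> real set) \<Rightarrow> real set \<Rightarrow> nat set \<Rightarrow> bool" where
  "omega_indices G X W \<longleftrightarrow> (\<forall>F. finite F \<and> F \<subseteq> X \<longrightarrow> (\<exists>i\<in>W. F \<subseteq> G i))"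

text \<open>
  The family \<open>W\<close> contains a sequence that eventually contains each point of \<open>T\<close>, and also each
  real whose digits 1 lie in the blocks of \<open>y\<close> with finitely many exceptions. The second part is a
  promise about points that have not been constructed yet: they will have this form.
\<close>

definition captures :: "(nat \<Rightarrow> real set) \<Rightarrow> real set \<Rightarrow> nat set \<Rightarrow> nat set \<Rightarrow> bool" where
  "captures G T y W \<longleftrightarrow> (\<exists>v :: nat \<Rightarrow> nat. range v \<subseteq> W \<and> (\<forall>t\<in>T. finite {i. t \<notin> G (v i)}) \<and>
     (\<forall>A. finite (A - block_support y) \<longrightarrow> finite {i. binary_value A \<notin> G (v i)}))"

text \<open>
  A gap in the set \<open>y\<close> of blocks becomes a gap in the digits. The digits outside the blocks of \<open>y\<close>
  are harmless because they lie before the gap.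
\<close>

lemma block_support_gap:
  assumes gap: "\<And>k. k \<in> y \<Longrightarrow> \<not> (n \<le> k \<and> k < m)"
    and A: "A - block_support y \<subseteq> {..<fact n}"
  shows "A \<inter> {fact n..<fact m} = {}"
proof -
  have False if j: "j \<in> A" "fact n \<le> j" "j < fact m" for j :: nat
  proof -
    have "j \<in> block_support y" using A j by force
    then obtain k where k: "k \<in> y" "fact k \<le> j" "j < fact (Suc k)"
      by (auto simp: block_support_def block_def)
    have "\<not> Suc k \<le> n" using fact_mono[of "Suc k" n, where 'a=nat] j k by linarith
    moreover have "\<not> m \<le> k" using fact_mono[of m k, where 'a=nat] j k by linarith
    ultimately show False using gap[OF k(1)] by simp
  qed
  then show ?thesis by auto
qed

text \<open>
  The argument of Galvin and Miller. Consider triples of naturals \<open>n < m\<close> and an index \<open>i\<close> in \<open>W\<close>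
  such that \<open>G i\<close> contains all reals with no digit 1 in the blocks from \<open>n\<close> to \<open>m - 1\<close>. By
  the \<open>\<omega>\<close>-cover property and the preceding neighbourhoods such triples exist with \<open>n\<close> arbitrarily
  large and \<open>G i\<close> containing any given finite subset of \<open>T\<close>. So the sets of triples whose \<open>G i\<close>
  contains a given \<open>t\<close> in \<open>T\<close>, and those with \<open>n\<close> above a given bound, form a centered family of
  size less than the continuum. From a pseudointersection pick triples that lie so far apart that \<open>x\<close>
  has an element between any two consecutive intervals from \<open>n\<close> to \<open>m - 1\<close>, and remove these
  intervals from \<open>x\<close>.
\<close>

lemma capture_on_subset:
  fixes T :: "real set" and G :: "nat \<Rightarrow> real set"
  assumes small: "\<And>F. centered F \<Longrightarrow> |F| <o |UNIV :: real set| \<Longrightarrow> \<exists>P. pseudointersection F P"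
    and T: "|T| <o |UNIV :: real set|"
    and G: "\<And>i. open (G i)"
    and W: "omega_indices G (finite_binaries \<union> T) W"
    and x: "infinite x"
  shows "\<exists>y\<subseteq>x. infinite y \<and> captures G T y W"
proof -
  \<comment> \<open>Naturals code triples with components \<open>a\<close>, \<open>b\<close> and \<open>v\<close>.\<close>
  define a where "a c = fst (prod_decode c)" for c
  define b where "b c = fst (prod_decode (snd (prod_decode c)))" for c
  define v where "v c = snd (prod_decode (snd (prod_decode c)))" for c
  define C where "C = {c. a c < b c \<and> v c \<in> W \<and>
    (\<forall>A. A \<inter> {fact (a c)..<fact (b c)} = {} \<longrightarrow> binary_value A \<in> G (v c))}"
  define E where "E t = {c \<in> C. t \<in> G (v c)}" for t
  define B where "B N = {c \<in> C. N \<le> a c}" for N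
  have key: "\<exists>c\<in>C. N \<le> a c \<and> (\<forall>t\<in>T0. t \<in> G (v c))" if T0: "finite T0" "T0 \<subseteq> T" for T0 N
  proof -
    have "binary_value A \<in> finite_binaries" if "A \<subseteq> {..<fact N}" for A
      unfolding finite_binaries_def using finite_subset[OF that] by auto
    then have "binary_value ` Pow {..<fact N} \<subseteq> finite_binaries" by (metis PowD image_subsetI)
    then have "T0 \<union> binary_value ` Pow {..<fact N} \<subseteq> finite_binaries \<union> T"
      using T0(2) by blast
    moreover have "finite (T0 \<union> binary_value ` Pow {..<fact N})" using T0(1) by simp
    ultimately obtain i where i: "i \<in> W" "T0 \<union> binary_value ` Pow {..<fact N} \<subseteq> G i"
      using W unfolding omega_indices_def by meson
    obtain m where m: "m > fact N" "\<And>A. A \<inter> {fact N..<m} = {} \<Longrightarrow> binary_value A \<in> G i"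
      using binary_cylinder_neighbourhood[OF G[of i], of "fact N"] i(2) by blast
    define c where "c = prod_encode (N, prod_encode (m, i))"
    have c: "a c = N" "b c = m" "v c = i" by (simp_all add: a_def b_def v_def c_def)
    have "N < m" using m(1) fact_ge_self[of N] by linarith
    moreover have "{fact N..<m} \<subseteq> {fact N..<fact m}" using fact_ge_self[of m] by auto
    ultimately have "c \<in> C" using i m(2) unfolding C_def c mem_Collect_eq by blast
    then show ?thesis using c i by (intro bexI[of _ c]) auto
  qed
  define F where "F = E ` T \<union> range B"
  have sub: "\<exists>P. pseudointersection H P" if H: "finite H" "H \<subseteq> F" for H
  proof -
    obtain T0 where T0: "finite T0" "T0 \<subseteq> T" "H \<inter> E ` T = E ` T0"
      using finite_subset_image[of "H \<inter> E ` T" E T] H(1) by blast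
    obtain N0 where N0: "finite N0" "H \<inter> range B = B ` N0"
      using finite_subset_image[of "H \<inter> range B" B UNIV] H(1) by blast
    define N where "N = Max (insert 0 N0)"
    define P where "P = {c \<in> C. N \<le> a c \<and> (\<forall>t\<in>T0. t \<in> G (v c))}"
    have "infinite P"
    proof
      assume fin: "finite P"
      define M where "M = Max (insert N (a ` P))"
      obtain c where c: "c \<in> C" "Suc M \<le> a c" "\<forall>t\<in>T0. t \<in> G (v c)" using key[OF T0(1,2)] by blast
      have "N \<le> M" using fin by (simp add: M_def)
      then have "c \<in> P" using c by (simp add: P_def)
      then have "a c \<le> M" using fin by (simp add: M_def)
      then show False using c by simp
    qed
    moreover have "finite (P - S)" if "S \<in> H" for S
    proof -
      have "S \<in> H \<inter> E ` T \<or> S \<in> H \<inter> range B" using that H(2) unfolding F_def by blast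
      then have "S \<in> E ` T0 \<or> S \<in> B ` N0" unfolding T0(3) N0(2) .
      moreover have "P \<subseteq> E t" if "t \<in> T0" for t using that by (auto simp: P_def E_def)
      moreover have "P \<subseteq> B n" if "n \<in> N0" for n
      proof -
        have "n \<le> N" using that N0(1) by (simp add: N_def)
        then show ?thesis by (auto simp: P_def B_def)
      qed
      ultimately have "P \<subseteq> S" by blast
      then have "P - S = {}" by blast
      then show ?thesis by (metis finite.emptyI)
    qed
    ultimately have "pseudointersection H P"
      unfolding pseudointersection_def almost_subset_def by simp
    then show ?thesis ..
  qed
  have "infinite S" if "S \<in> F" for S
  proof -
    have "finite {S}" "{S} \<subseteq> F" using that by auto
    then obtain P where "pseudointersection {S} P" using sub by blast
    then have "infinite P" "finite (P - S)"
      unfolding pseudointersection_def almost_subset_def by auto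
    then show ?thesis using Diff_infinite_finite[of S P] by blast
  qed
  with sub have "centered F" unfolding centered_def by blast
  moreover have "|F| <o |UNIV :: real set|"
    unfolding F_def
  proof (rule card_of_Un_ordLess_infinite)
    show "infinite (UNIV :: real set)" by (rule infinite_UNIV_char_0)
    show "|E ` T| <o |UNIV :: real set|" using card_of_image T by (rule ordLeq_ordLess_trans)
    show "|range B| <o |UNIV :: real set|"
      using card_of_image nat_ordLess_real by (rule ordLeq_ordLess_trans)
  qed
  ultimately obtain P where "pseudointersection F P" using small by blast
  then have P: "infinite P" "\<And>t. t \<in> T \<Longrightarrow> finite (P - E t)" "\<And>N. finite (P - B N)"
    by (auto simp: pseudointersection_def almost_subset_def F_def)
  have late: "\<exists>c. c \<in> P \<inter> C \<and> M < a c" for M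
  proof -
    have "infinite (P \<inter> B (Suc M))" using P(1,3) by (metis Int_Diff_Un finite_UnI)
    then obtain c where "c \<in> P \<inter> B (Suc M)" by (metis ex_in_conv finite.emptyI)
    then show ?thesis by (auto simp: B_def)
  qed
  have "\<exists>s. \<forall>i::nat. s i \<in> P \<inter> C \<and> (\<exists>j\<in>x. b (s i) \<le> j \<and> j < a (s (Suc i)))"
  proof (rule dependent_nat_choice)
    show "\<exists>c. c \<in> P \<inter> C" using late by blast
    show "\<exists>c'. c' \<in> P \<inter> C \<and> (\<exists>j\<in>x. b c \<le> j \<and> j < a c')" for c :: nat
    proof -
      obtain j where "j \<in> x" "b c \<le> j" using x unfolding infinite_nat_iff_unbounded_le by blast
      then show ?thesis using late[of j] by blast
    qed
  qed
  then obtain s where s_all: "\<forall>i. s i \<in> P \<inter> C \<and> (\<exists>j\<in>x. b (s i) \<le> j \<and> j < a (s (Suc i)))"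
    by (elim exE)
  then have s: "s i \<in> P" "s i \<in> C" for i by auto
  have gap: "\<exists>j\<in>x. b (s i) \<le> j \<and> j < a (s (Suc i))" for i using s_all by blast
  have ab: "a (s i) < b (s i)" for i using s(2)[of i] by (simp add: C_def)
  have ba: "b (s i) < a (s (Suc i))" for i using gap[of i] by auto
  have mono_a: "strict_mono (\<lambda>i. a (s i))"
    using less_trans[OF ab ba] by (simp add: strict_mono_Suc_iff)
  have mono_b: "strict_mono (\<lambda>i. b (s i))"
    using less_trans[OF ba ab] by (simp add: strict_mono_Suc_iff)
  have inj: "inj s" by (rule injI) (metis strict_mono_eq[OF mono_a])
  have a_ge: "i \<le> a (s i)" for i using strict_mono_imp_increasing[OF mono_a, of i] .
  define y where "y = {j \<in> x. \<forall>i. \<not> (a (s i) \<le> j \<and> j < b (s i))}"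
  have "infinite y"
    unfolding infinite_nat_iff_unbounded_le
  proof
    fix n
    obtain j where j: "j \<in> x" "b (s n) \<le> j" "j < a (s (Suc n))" using gap by blast
    have "\<not> (a (s i) \<le> j \<and> j < b (s i))" for i
    proof (cases "i \<le> n")
      case True
      then have "b (s i) \<le> b (s n)" using strict_mono_less_eq[OF mono_b] by simp
      then show ?thesis using j by simp
    next
      case False
      then have "a (s (Suc n)) \<le> a (s i)" using strict_mono_less_eq[OF mono_a] by simp
      then show ?thesis using j by simp
    qed
    then have "j \<in> y" using j by (simp add: y_def)
    moreover have "n \<le> j" using j(2) a_ge[of n] ab[of n] by simp
    ultimately show "\<exists>j\<ge>n. j \<in> y" by blast
  qed
  moreover have "captures G T y W"
    unfolding captures_def
  proof (intro exI[of _ "\<lambda>i. v (s i)"] conjI ballI allI impI)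
    show "range (\<lambda>i. v (s i)) \<subseteq> W" using s(2) by (auto simp: C_def)
    show "finite {i. t \<notin> G (v (s i))}" if "t \<in> T" for t
    proof (rule finite_subset)
      show "{i. t \<notin> G (v (s i))} \<subseteq> s -` (P - E t)" using s(1) by (auto simp: E_def)
      show "finite (s -` (P - E t))" using P(2)[OF that] inj by (rule finite_vimageI)
    qed
    show "finite {i. binary_value A \<notin> G (v (s i))}" if "finite (A - block_support y)" for A
    proof -
      from that obtain K where K: "A - block_support y \<subseteq> {..<K}"
        unfolding finite_nat_iff_bounded by blast
      have "binary_value A \<in> G (v (s i))" if "K \<le> i" for i
      proof -
        have "K \<le> fact (a (s i))" using that a_ge[of i] fact_ge_self[of "a (s i)"] by linarith
        then have "A \<inter> {fact (a (s i))..<fact (b (s i))} = {}"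
          using K by (intro block_support_gap[of y]) (auto simp: y_def)
        then show ?thesis using s(2)[of i] by (simp add: C_def)
      qed
      then have "{i. binary_value A \<notin> G (v (s i))} \<subseteq> {..<K}" by (auto simp: not_le[symmetric])
      then show ?thesis by (rule finite_subset) simp
    qed
  qed
  moreover have "y \<subseteq> x" by (auto simp: y_def)
  ultimately show ?thesis by blast
qed

section \<open>The tower and the gamma-set\<close>

text \<open>
  The stages of the transfinite construction are indexed by sets of naturals. The even elements of
  an index \<open>\<alpha>\<close> code the family of open sets that stage \<open>\<alpha>\<close> has to capture, and the odd ones the
  binary expansion of the real that has to be reached as a sum. The point added at this stage keeps
  only those digits of the expansion that lie in the blocks of \<open>y\<close>.
\<close>

definition tower_point :: "nat set \<Rightarrow> nat set \<Rightarrow> real" where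
  "tower_point \<alpha> y = binary_value ({n. 2 * n + 1 \<in> \<alpha>} \<inter> block_support y)"

definition tower_family :: "nat set \<Rightarrow> nat set" where
  "tower_family \<alpha> = {n. 2 * n \<in> \<alpha>}"

lemma stage_exists:
  "\<exists>\<alpha>. tower_family \<alpha> = W \<and> {n. 2 * n + 1 \<in> \<alpha>} = A"
proof (intro exI conjI)
  let ?\<alpha> = "(\<lambda>n. 2 * n) ` W \<union> (\<lambda>n. 2 * n + 1) ` A"
  show "tower_family ?\<alpha> = W" by (auto simp: tower_family_def) presburger+
  show "{n. 2 * n + 1 \<in> ?\<alpha>} = A" by auto presburger+
qed

text \<open>
  Transfinite recursion along a well-order of type continuum. The sets of blocks chosen at earlier
  stages decrease modulo finite sets, hence are centered, and there are fewer than continuum many of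
  them. They have a pseudointersection, which is then thinned out to capture the family of the
  current stage together with all earlier points.
\<close>

lemma tower_exists:
  fixes G :: "nat \<Rightarrow> real set"
  assumes small: "\<And>F. centered F \<Longrightarrow> |F| <o |UNIV :: real set| \<Longrightarrow> \<exists>P. pseudointersection F P"
    and G: "\<And>i. open (G i)"
  shows "\<exists>(R :: nat set rel) y. total R \<and> (\<forall>\<alpha>. infinite (y \<alpha>) \<and>
      (\<forall>\<beta>. (\<beta>, \<alpha>) \<in> R \<longrightarrow> almost_subset (y \<alpha>) (y \<beta>)) \<and>
      (let T = {tower_point \<beta> (y \<beta>) | \<beta>. (\<beta>, \<alpha>) \<in> R} in
        omega_indices G (finite_binaries \<union> T) (tower_family \<alpha>) \<longrightarrow>
        captures G T (y \<alpha>) (tower_family \<alpha>)))"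
proof -
  define r where "r = |UNIV :: nat set set|"
  define R where "R = r - Id"
  have wo: "Well_order r" unfolding r_def by (rule card_of_Well_order)
  have Fr: "Field r = UNIV" unfolding r_def by (rule Field_card_of)
  have lin: "Linear_order r" and wf: "wf R"
    using wo unfolding well_order_on_def R_def by auto
  have trans: "trans R"
    using lin unfolding R_def linear_order_on_def partial_order_on_def preorder_on_def
    by (auto intro: trans_diff_Id)
  have tot: "total R"
    using lin Fr unfolding linear_order_on_def R_def by (auto simp: total_on_def)
  have seg: "|{\<beta>. (\<beta>, \<alpha>) \<in> R}| <o |UNIV :: real set|" for \<alpha>
  proof -
    have "{\<beta>. (\<beta>, \<alpha>) \<in> R} = underS r \<alpha>" by (auto simp: R_def underS_def)
    then have "|{\<beta>. (\<beta>, \<alpha>) \<in> R}| <o r"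
      using card_of_underS[of r \<alpha>] Fr by (simp add: r_def card_of_Card_order)
    moreover obtain f :: "nat set \<Rightarrow> real" where "inj f"
      using eqpoll_imp_lepoll[OF nat_sets_eqpoll_reals] unfolding lepoll_def by blast
    then have "r \<le>o |UNIV :: real set|"
      unfolding r_def card_of_ordLeq[symmetric] by blast
    ultimately show ?thesis by (rule ordLess_ordLeq_trans)
  qed
  define good where "good y \<alpha> z \<longleftrightarrow> infinite z \<and>
      (\<forall>\<beta>. (\<beta>, \<alpha>) \<in> R \<longrightarrow> almost_subset z (y \<beta>)) \<and>
      (let T = {tower_point \<beta> (y \<beta>) | \<beta>. (\<beta>, \<alpha>) \<in> R} in
        omega_indices G (finite_binaries \<union> T) (tower_family \<alpha>) \<longrightarrow>
        captures G T z (tower_family \<alpha>))" for y \<alpha> z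
  have "\<exists>y. \<forall>\<alpha>. good y \<alpha> (y \<alpha>)"
  proof (rule dependent_wf_choice[OF wf])
    fix y y' :: "nat set \<Rightarrow> nat set" and \<alpha> z
    assume eq: "\<And>\<beta>. (\<beta>, \<alpha>) \<in> R \<Longrightarrow> y \<beta> = y' \<beta>"
    then have "{tower_point \<beta> (y \<beta>) | \<beta>. (\<beta>, \<alpha>) \<in> R} = {tower_point \<beta> (y' \<beta>) | \<beta>. (\<beta>, \<alpha>) \<in> R}"
      by metis
    then show "good y \<alpha> z = good y' \<alpha> z" using eq unfolding good_def by simp
  next
    fix \<alpha> and y :: "nat set \<Rightarrow> nat set"
    assume IH: "\<And>\<beta>. (\<beta>, \<alpha>) \<in> R \<Longrightarrow> good y \<beta> (y \<beta>)"
    let ?S = "{\<beta>. (\<beta>, \<alpha>) \<in> R}"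
    have inf: "infinite (y \<beta>)" if "\<beta> \<in> ?S" for \<beta> using IH that unfolding good_def by blast
    have dec: "almost_subset (y \<beta>) (y \<gamma>)" if "\<beta> \<in> ?S" "(\<gamma>, \<beta>) \<in> R" for \<beta> \<gamma>
      using IH[of \<beta>] that unfolding good_def by blast
    have last: "\<exists>\<mu>\<in>K. \<forall>\<beta>\<in>K. \<beta> = \<mu> \<or> (\<beta>, \<mu>) \<in> R" if "finite K" "K \<noteq> {}" for K
      using that
    proof (induction K rule: finite_ne_induct)
      case (insert \<beta> K)
      then obtain \<mu> where \<mu>: "\<mu> \<in> K" "\<forall>\<beta>\<in>K. \<beta> = \<mu> \<or> (\<beta>, \<mu>) \<in> R" by blast
      consider "\<beta> = \<mu>" | "(\<beta>, \<mu>) \<in> R" | "(\<mu>, \<beta>) \<in> R"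
        using tot unfolding total_on_def by blast
      then show ?case using \<mu> trans by cases (auto dest: transD)
    qed simp
    have "centered (y ` ?S)"
      unfolding centered_def
    proof (intro conjI ballI allI impI)
      show "infinite B" if "B \<in> y ` ?S" for B using that inf by blast
      fix H assume "finite H \<and> H \<subseteq> y ` ?S"
      then obtain K where K: "finite K" "K \<subseteq> ?S" "H = y ` K" by (meson finite_subset_image)
      show "\<exists>P. pseudointersection H P"
      proof (cases "K = {}")
        case True
        then show ?thesis
          using K by (auto simp: pseudointersection_def intro!: exI[of _ UNIV])
      next
        case False
        then obtain \<mu> where \<mu>: "\<mu> \<in> K" "\<forall>\<beta>\<in>K. \<beta> = \<mu> \<or> (\<beta>, \<mu>) \<in> R" using last K(1) by blast
        have "almost_subset (y \<mu>) (y \<beta>)" if "\<beta> \<in> K" for \<beta>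
        proof (cases "\<beta> = \<mu>")
          case True
          then show ?thesis by (simp add: almost_subset_def)
        next
          case False
          then show ?thesis using \<mu> that K(2) dec by blast
        qed
        moreover have "infinite (y \<mu>)" using inf \<mu>(1) K(2) by blast
        ultimately show ?thesis unfolding pseudointersection_def K(3) by blast
      qed
    qed
    moreover have "|y ` ?S| <o |UNIV :: real set|"
      using card_of_image seg by (rule ordLeq_ordLess_trans)
    ultimately obtain x where "pseudointersection (y ` ?S) x" using small by blast
    then have x: "infinite x" "\<And>\<beta>. \<beta> \<in> ?S \<Longrightarrow> almost_subset x (y \<beta>)"
      by (auto simp: pseudointersection_def)
    define T where "T = {tower_point \<beta> (y \<beta>) | \<beta>. (\<beta>, \<alpha>) \<in> R}"
    have T: "|T| <o |UNIV :: real set|"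
    proof -
      have "T = (\<lambda>\<beta>. tower_point \<beta> (y \<beta>)) ` ?S" by (auto simp: T_def)
      then show ?thesis using ordLeq_ordLess_trans[OF card_of_image seg] by simp
    qed
    obtain z where z: "z \<subseteq> x" "infinite z"
      "omega_indices G (finite_binaries \<union> T) (tower_family \<alpha>) \<longrightarrow> captures G T z (tower_family \<alpha>)"
    proof (cases "omega_indices G (finite_binaries \<union> T) (tower_family \<alpha>)")
      case True
      obtain z where "z \<subseteq> x" "infinite z" "captures G T z (tower_family \<alpha>)"
        using capture_on_subset[OF small T G True x(1)] by blast
      then show ?thesis using that by blast
    next
      case False
      then show ?thesis using that[of x] x(1) by blast
    qed
    have "almost_subset z (y \<beta>)" if "\<beta> \<in> ?S" for \<beta>
      using x(2)[OF that] z(1) unfolding almost_subset_def by (meson Diff_mono finite_subset order_refl)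
    then have "good y \<alpha> z" using z unfolding good_def T_def Let_def by blast
    then show "\<exists>z. good y \<alpha> z" ..
  qed
  then show ?thesis using tot unfolding good_def by blast
qed

text \<open>
  Finite unions of members of a countable base. With them an arbitrary \<open>\<omega>\<close>-cover can be replaced by
  one coded by a set of naturals.
\<close>

lemma ex_open_sequence_between:
  "\<exists>G :: nat \<Rightarrow> real set. (\<forall>i. open (G i)) \<and>
     (\<forall>F U. finite F \<and> open U \<and> F \<subseteq> U \<longrightarrow> (\<exists>i. F \<subseteq> G i \<and> G i \<subseteq> U))"
proof -
  obtain B :: "real set set" where count: "countable B" and basis: "topological_basis B"
    using ex_countable_basis by blast
  define D where "D = Union ` {H. finite H \<and> H \<subseteq> B}"
  have D: "countable D" "D \<noteq> {}"
    using countable_Collect_finite_subset[OF count] by (auto simp: D_def)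
  define G where "G = from_nat_into D"
  have G: "range G = D" unfolding G_def using D by (simp add: range_from_nat_into)
  have "open (G i)" for i
  proof -
    have "G i \<in> D" using G by blast
    then obtain H where "G i = \<Union>H" "H \<subseteq> B" unfolding D_def by blast
    then show ?thesis using topological_basis_open[OF basis] by (metis open_Union subsetD)
  qed
  moreover have "\<exists>i. F \<subseteq> G i \<and> G i \<subseteq> U" if U: "finite F" "open U" "F \<subseteq> U" for F U
  proof -
    obtain B' where B': "B' \<subseteq> B" "U = \<Union>B'"
      using basis U(2) unfolding topological_basis_def by metis
    then obtain H where H: "finite H" "H \<subseteq> B'" "F \<subseteq> \<Union>H"
      using finite_subset_Union[OF U(1)] U(3) by metis
    then have "\<Union>H \<in> range G" unfolding G D_def using B' by blast
    then obtain i where "\<Union>H = G i" by blast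
    then show ?thesis using H B' by blast
  qed
  ultimately show ?thesis by blast
qed

lemma finite_block_support_diff:
  assumes "almost_subset y z"
  shows "finite (block_support y - block_support z)"
proof (rule finite_subset)
  show "block_support y - block_support z \<subseteq> (\<Union>n\<in>y - z. block n)"
    by (auto simp: block_support_def)
  show "finite (\<Union>n\<in>y - z. block n)"
    using assms by (auto simp: almost_subset_def block_def)
qed

text \<open>
  A given \<open>\<omega>\<close>-cover is refined by the sets \<open>G i\<close> whose trace on \<open>X\<close> lies in one of its members,
  and a sequence of such \<open>G i\<close> lifts to a sequence \<open>u\<close> of members. The range of \<open>u\<close> is infinite
  because a member that occurs infinitely often would contain all of \<open>X\<close>.
\<close>

lemma gamma_set_if_eventually_covered:
  fixes G :: "nat \<Rightarrow> real set"
  assumes between: "\<And>F U. finite F \<Longrightarrow> open U \<Longrightarrow> F \<subseteq> U \<Longrightarrow> \<exists>i. F \<subseteq> G i \<and> G i \<subseteq> U"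
    and seq: "\<And>W. omega_indices G X W \<Longrightarrow>
      \<exists>v :: nat \<Rightarrow> nat. range v \<subseteq> W \<and> (\<forall>x\<in>X. finite {i. x \<notin> G (v i)})"
  shows "gamma_set X"
  unfolding gamma_set_def gamma_space_def
proof (intro allI impI)
  fix U assume "open_omega_cover (top_of_set X) U"
  then have opn: "\<And>u. u \<in> U \<Longrightarrow> openin (top_of_set X) u"
    and fin: "\<And>F. finite F \<Longrightarrow> F \<subseteq> X \<Longrightarrow> \<exists>u\<in>U. F \<subseteq> u"
    and proper: "\<And>u. u \<in> U \<Longrightarrow> \<not> X \<subseteq> u"
    by (auto simp: open_omega_cover_def)
  define W where "W = {i. \<exists>u\<in>U. G i \<inter> X \<subseteq> u}"
  have "omega_indices G X W"
    unfolding omega_indices_def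
  proof (intro allI impI)
    fix F assume F: "finite F \<and> F \<subseteq> X"
    then obtain u where u: "u \<in> U" "F \<subseteq> u" using fin by blast
    obtain S where S: "open S" "u = X \<inter> S" using opn[OF u(1)] by (auto simp: openin_open)
    have "F \<subseteq> S" using u(2) S(2) by blast
    with between S(1) F obtain i where i: "F \<subseteq> G i" "G i \<subseteq> S" by meson
    then have "G i \<inter> X \<subseteq> u" using S(2) by blast
    then have "i \<in> W" using u(1) by (auto simp: W_def)
    then show "\<exists>i\<in>W. F \<subseteq> G i" using i(1) by blast
  qed
  from seq[OF this] obtain v :: "nat \<Rightarrow> nat"
    where v: "range v \<subseteq> W" "\<forall>x\<in>X. finite {i. x \<notin> G (v i)}"
    by blast
  have "\<forall>i::nat. \<exists>u\<in>U. G (v i) \<inter> X \<subseteq> u" using v(1) unfolding W_def by blast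
  then obtain u where u: "\<And>i. u i \<in> U" "\<And>i. G (v i) \<inter> X \<subseteq> u i" by metis
  have fin_miss: "finite {i. x \<notin> u i}" if "x \<in> X" for x
    using u(2) that by (intro finite_subset[OF _ bspec[OF v(2) that]]) blast
  have "gamma_cover (top_of_set X) (range u)"
    unfolding gamma_cover_def cover_of_def topspace_euclidean_subtopology
  proof (intro conjI ballI)
    show "\<Union>(range u) = X"
    proof
      show "\<Union>(range u) \<subseteq> X" using u(1) opn by (meson UN_least openin_imp_subset)
      show "X \<subseteq> \<Union>(range u)"
      proof
        fix x assume "x \<in> X"
        then have "{i. x \<notin> u i} \<noteq> UNIV" using fin_miss infinite_UNIV_nat by metis
        then show "x \<in> \<Union>(range u)" by blast
      qed
    qed
    show "infinite (range u)"
    proof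
      assume "finite (range u)"
      then obtain i where i: "infinite {j. u j = u i}"
        using pigeonhole_infinite[of UNIV u] infinite_UNIV_nat by auto
      have "x \<in> u i" if "x \<in> X" for x
      proof (rule ccontr)
        assume "x \<notin> u i"
        then have "{j. u j = u i} \<subseteq> {j. x \<notin> u j}" by auto
        then show False using i fin_miss[OF that] finite_subset by blast
      qed
      then show False using proper[OF u(1)] by blast
    qed
    show "finite {w \<in> range u. x \<notin> w}" if "x \<in> X" for x
    proof (rule finite_subset)
      show "{w \<in> range u. x \<notin> w} \<subseteq> u ` {i. x \<notin> u i}" by blast
    qed (use fin_miss[OF that] in simp)
  qed
  then show "\<exists>V\<subseteq>U. gamma_cover (top_of_set X) V" using u(1) by blast
qed

text \<open>
  Let \<open>W\<close> code an \<open>\<omega>\<close>-cover of the set of all points and let \<open>\<alpha>\<close> be a stage for \<open>W\<close>. The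
  earlier points are captured by the choice of \<open>y \<alpha>\<close>. The points of stage \<open>\<alpha>\<close> and of all later
  ones have their digits, up to finitely many, in the blocks of \<open>y \<alpha>\<close>, because the tower decreases
  modulo finite sets, so they are captured as well. On the other hand, a real with expansion \<open>A\<close> is
  the sum of the point of a stage for \<open>A\<close> and of the number with the remaining digits, and those
  have a gap at each of the infinitely many blocks of \<open>y \<alpha>\<close>.
\<close>

lemma ex_gamma_set_sum_contains_interval:
  assumes hyp: "continuum_hypothesis \<or> cardinal_p =o cardinal_c"
  shows "\<exists>X. gamma_set X \<and> X \<subseteq> {0..1} \<and> {0..<1} \<subseteq> {x + y | x y. x \<in> X \<and> y \<in> sparse_reals}"
proof -
  note small = small_centered_has_pseudointersection[OF hyp]
  obtain G :: "nat \<Rightarrow> real set" where G: "\<And>i. open (G i)"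
    and between: "\<And>F U. finite F \<Longrightarrow> open U \<Longrightarrow> F \<subseteq> U \<Longrightarrow> \<exists>i. F \<subseteq> G i \<and> G i \<subseteq> U"
    using ex_open_sequence_between by metis
  have "\<exists>(R :: nat set rel) y. total R \<and> (\<forall>\<alpha>. infinite (y \<alpha>) \<and>
      (\<forall>\<beta>. (\<beta>, \<alpha>) \<in> R \<longrightarrow> almost_subset (y \<alpha>) (y \<beta>)) \<and>
      (let T = {tower_point \<beta> (y \<beta>) | \<beta>. (\<beta>, \<alpha>) \<in> R} in
        omega_indices G (finite_binaries \<union> T) (tower_family \<alpha>) \<longrightarrow>
        captures G T (y \<alpha>) (tower_family \<alpha>)))"
    by (rule tower_exists) (fact small, fact G)
  then obtain R :: "nat set rel" and y where tot: "total R"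
    and tower: "\<forall>\<alpha>. infinite (y \<alpha>) \<and>
      (\<forall>\<beta>. (\<beta>, \<alpha>) \<in> R \<longrightarrow> almost_subset (y \<alpha>) (y \<beta>)) \<and>
      (let T = {tower_point \<beta> (y \<beta>) | \<beta>. (\<beta>, \<alpha>) \<in> R} in
        omega_indices G (finite_binaries \<union> T) (tower_family \<alpha>) \<longrightarrow>
        captures G T (y \<alpha>) (tower_family \<alpha>))"
    by (elim exE conjE)
  have inf: "infinite (y \<alpha>)"
    and dec: "(\<beta>, \<alpha>) \<in> R \<Longrightarrow> almost_subset (y \<alpha>) (y \<beta>)"
    and capt: "omega_indices G (finite_binaries \<union> {tower_point \<beta> (y \<beta>) | \<beta>. (\<beta>, \<alpha>) \<in> R}) (tower_family \<alpha>) \<Longrightarrow>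
        captures G {tower_point \<beta> (y \<beta>) | \<beta>. (\<beta>, \<alpha>) \<in> R} (y \<alpha>) (tower_family \<alpha>)" for \<alpha> \<beta>
    using tower unfolding Let_def by blast+
  define X where "X = finite_binaries \<union> range (\<lambda>\<alpha>. tower_point \<alpha> (y \<alpha>))"
  have "gamma_set X"
  proof (rule gamma_set_if_eventually_covered[OF between])
    fix W assume W: "omega_indices G X W"
    obtain \<alpha> where \<alpha>: "tower_family \<alpha> = W" using stage_exists by blast
    let ?T = "{tower_point \<beta> (y \<beta>) | \<beta>. (\<beta>, \<alpha>) \<in> R}"
    have "finite_binaries \<union> ?T \<subseteq> X" by (auto simp: X_def)
    with W have "omega_indices G (finite_binaries \<union> ?T) W"
      unfolding omega_indices_def by (meson order_trans)
    then have "captures G ?T (y \<alpha>) W" using capt[of \<alpha>] unfolding \<alpha> by blast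
    then obtain v :: "nat \<Rightarrow> nat" where v_W: "range v \<subseteq> W"
      and v_T: "\<forall>t\<in>?T. finite {i. t \<notin> G (v i)}"
      and v_bin: "\<forall>A. finite (A - block_support (y \<alpha>)) \<longrightarrow> finite {i. binary_value A \<notin> G (v i)}"
      unfolding captures_def by (elim exE conjE)
    have "finite {i. x \<notin> G (v i)}" if x: "x \<in> X" for x
    proof -
      consider A where "finite A" "x = binary_value A" | \<beta> where "x = tower_point \<beta> (y \<beta>)"
        using x unfolding X_def finite_binaries_def by blast
      then show ?thesis
      proof cases
        case 1
        then show ?thesis using v_bin by simp
      next
        case 2
        have "\<beta> = \<alpha> \<or> (\<beta>, \<alpha>) \<in> R \<or> (\<alpha>, \<beta>) \<in> R"
          using tot unfolding total_on_def by blast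
        then have "(\<beta>, \<alpha>) \<in> R \<or> almost_subset (y \<beta>) (y \<alpha>)"
          using dec[of \<alpha> \<beta>] by (auto simp: almost_subset_def)
        then consider "(\<beta>, \<alpha>) \<in> R" | "almost_subset (y \<beta>) (y \<alpha>)" by argo
        then show ?thesis
        proof cases
          case 1
          then have "x \<in> ?T" using \<open>x = tower_point \<beta> (y \<beta>)\<close> by blast
          with v_T show ?thesis by (rule bspec)
        next
          case 2
          then have "finite ({n. 2 * n + 1 \<in> \<beta>} \<inter> block_support (y \<beta>) - block_support (y \<alpha>))"
            by (rule finite_subset[OF _ finite_block_support_diff, rotated]) blast
          then show ?thesis using v_bin \<open>x = tower_point \<beta> (y \<beta>)\<close> by (simp add: tower_point_def)
        qed
      qed
    qed
    then show "\<exists>v :: nat \<Rightarrow> nat. range v \<subseteq> W \<and> (\<forall>x\<in>X. finite {i. x \<notin> G (v i)})"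
      using v_W by blast
  qed
  moreover have "X \<subseteq> {0..1}"
    using binary_value_nonneg binary_value_le_1
    by (auto simp: X_def finite_binaries_def tower_point_def)
  moreover have "z \<in> {x + y | x y. x \<in> X \<and> y \<in> sparse_reals}" if z: "z \<in> {0..<1}" for z
  proof -
    obtain A where A: "z = binary_value A" using binary_value_surj[of z] z by auto
    \<comment> \<open>Any coded family will do here.\<close>
    obtain \<alpha> where \<alpha>: "{n. 2 * n + 1 \<in> \<alpha>} = A" using stage_exists by blast
    let ?S = "block_support (y \<alpha>)"
    have "(A - ?S) \<inter> block n = {}" if "n \<in> y \<alpha>" for n
      using that by (auto simp: block_support_def)
    then have "\<exists>\<^sub>\<infinity>n. (A - ?S) \<inter> block n = {}"
      using inf[of \<alpha>] unfolding frequently_cofinite by (metis (mono_tags, lifting) finite_subset mem_Collect_eq subsetI)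
    then have "binary_value (A - ?S) \<in> sparse_reals" by (auto simp: sparse_reals_def)
    moreover have "binary_value (A \<inter> ?S) \<in> X" using \<alpha> by (auto simp: X_def tower_point_def)
    ultimately show ?thesis using A binary_value_split[of A ?S] by blast
  qed
  ultimately show ?thesis by blast
qed

theorem theorem4:
  assumes "continuum_hypothesis \<or> cardinal_p =o cardinal_c"
  shows "\<exists>X Y :: real set. gamma_set X \<and> hausdorff_dim Y = 0 \<and>
           hausdorff_dim {x + y | x y. x \<in> X \<and> y \<in> Y} = 1 \<and>
           hausdorff_dim (X \<times> Y) \<ge> 1"
proof -
  obtain X where X: "gamma_set X" "X \<subseteq> {0..1}"
    and cover: "{0..<1} \<subseteq> {x + y | x y. x \<in> X \<and> y \<in> sparse_reals}"
    using ex_gamma_set_sum_contains_interval[OF assms] by blast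
  let ?S = "{x + y | x y. x \<in> X \<and> y \<in> sparse_reals}"
  have "sparse_reals \<subseteq> {0..1}"
    using binary_value_nonneg binary_value_le_1 by (auto simp: sparse_reals_def)
  then have "?S \<subseteq> {0..2}" using X(2) by (fastforce simp: subset_iff)
  then have "bounded ?S" using bounded_closed_interval bounded_subset by blast
  then have "hausdorff_dim ?S \<le> 1" by (rule hausdorff_dim_bounded_real_le_1)
  moreover have ge: "1 \<le> hausdorff_dim ?S" using cover by (rule hausdorff_dim_ge_1_if_contains_interval)
  ultimately have sum: "hausdorff_dim ?S = 1" by (rule antisym)
  have "2-lipschitz_on (X \<times> sparse_reals) (\<lambda>p. fst p + snd p)"
  proof (rule lipschitz_onI)
    fix p q :: "real \<times> real"
    have "dist (fst p + snd p) (fst q + snd q) \<le> dist (fst p) (fst q) + dist (snd p) (snd q)"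
      by (simp add: dist_real_def)
    also have "\<dots> \<le> 2 * dist p q" using dist_fst_le[of p q] dist_snd_le[of p q] by linarith
    finally show "dist (fst p + snd p) (fst q + snd q) \<le> 2 * dist p q" .
  qed simp
  then have "hausdorff_dim ((\<lambda>p. fst p + snd p) ` (X \<times> sparse_reals)) \<le> hausdorff_dim (X \<times> sparse_reals)"
    by (rule hausdorff_dim_lipschitz_image)
  moreover have "(\<lambda>p. fst p + snd p) ` (X \<times> sparse_reals) = ?S" by force
  ultimately have "1 \<le> hausdorff_dim (X \<times> sparse_reals)" using ge by simp
  then show ?thesis using X(1) hausdorff_dim_sparse_reals sum by blast
qed

end
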